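(* Let $n,q\geq 1$ be integers. Then $$\sum_{\substack{k_{1},\dots,k_n\geq0\\ k_{1}+\cdots+k_n=n}}\binom{n}{k_{1},\dots,k_n}\left(\sum_{i=1}^nk_{i}^q\right)=n^{n-(q-2)}\sum_{k=0}^{q-1}(-1)^{k}\left(\sum_{j=1}^{q-k}{q \brace k+j}{k+j \brack j}\right)n^{q-k-1},$$ where the sum on the left-hand side is over all $n$-tuples of nonnegative integers $(k_1,\ldots,k_n)$ with sum $n$. In particular, $$\sum_{k=0}^{q-1}(-1)^{k}\left(\sum_{j=1}^{q-k}{q \brace k+j}{k+j \brack j}\right)=1.$$
   Context: The symbol ${n\brace k}$ denotes the Stirling number of the second kind (the number of partitions of an $n$-element set into $k$ nonempty blocks), and ${n\brack k}$ denotes the (unsigned) Stirling number of the first kind (the number of permutations of $n$ elements with exactly $k$ cycles). The symbol $\binom{n}{k_1,\ldots,k_n}=\frac{n!}{k_1!\cdots k_n!}$ is the multinomial coefficient. The exponent $n-(q-2)$ may be negative, so the identity is one between rational numbers. *)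

theory Defs
  imports Complex_Main "HOL-Library.FuncSet" "HOL-Combinatorics.Stirling"
begin

text \<open>
  \<open>Stirling\<close> (capital S) from \<^theory>\<open>HOL-Combinatorics.Stirling\<close> gives the Stirling numbers of the
  second kind, \<open>stirling\<close> (lower case) the unsigned Stirling numbers of the first kind.
\<close>

definition multinomial :: "nat \<Rightarrow> (nat \<Rightarrow> nat) \<Rightarrow> rat"
  where "multinomial n k = fact n / (\<Prod>i=1..n. fact (k i))"

text \<open>
  The tuples \<open>(k\<^sub>1, \<dots>, k\<^sub>n)\<close> of natural numbers with \<open>k\<^sub>1 + \<dots> + k\<^sub>n = n\<close>.
  Using \<open>\<rightarrow>\<^sub>E\<close> makes each function \<open>undefined\<close> outside \<open>{1..n}\<close>,
  so that every tuple is represented by exactly one function.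
\<close>

definition tuples_with_sum :: "nat \<Rightarrow> (nat \<Rightarrow> nat) set"
  where "tuples_with_sum n = {k \<in> {1..n} \<rightarrow>\<^sub>E UNIV. (\<Sum>i=1..n. k i) = n}"

end

theory Submission
  imports Defs "HOL-Computational_Algebra.Formal_Power_Series"
begin

text \<open>
  Both claims come from expanding a power in falling factorials \<open>m! * binom(x, m)\<close>. Write
  \<open>x ^ q = (\<Sum>m\<le>q. Stirling q m * m! * binom(x, m))\<close> (\<open>power_eq_sum_Stirling_binomial\<close>). The binomial
  moments of one coordinate of a tuple are easy: the multinomially weighted sum of
  \<open>binom(k\<^sub>i, m)\<close> over all tuples with sum \<open>n\<close> is \<open>binom(n, m) * n ^ (n - m)\<close>
  (\<open>sum_multinomial_binomial\<close>), because it counts the maps from an \<open>n\<close>-set to the \<open>n\<close> coordinates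
  together with an \<open>m\<close>-subset that is sent to \<open>i\<close>. This count does not depend on \<open>i\<close>, so the left-hand
  side is \<open>n * (\<Sum>m\<le>q. Stirling q m * m! * binom(n, m) * n ^ (n - m))\<close>.

  The Stirling numbers of the first kind expand each falling factorial \<open>m! * binom(n, m)\<close> back into
  powers of \<open>n\<close>. Collecting the terms by \<open>k = m - j\<close>, where \<open>j\<close> is the exponent in that expansion,
  produces the inner double sum of the theorem
  (\<open>sum_Stirling_binomial_eq_sum_Stirling_stirling\<close>).

  That last identity also holds with \<open>x\<close> in place of \<open>n\<close> for every natural number \<open>x\<close>. At \<open>x = 1\<close> all
  powers of \<open>x\<close> disappear and its left-hand side is the expansion of \<open>1 ^ q\<close>; this is the second claim.
\<close>

text \<open>
  The recurrence of the Stirling numbers of the second kind mirrors how multiplication by \<open>x\<close>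
  acts on the falling factorials \<open>g m = m! * binom(x, m)\<close>, namely \<open>x * g m = m * g m + g (m + 1)\<close>.
\<close>

lemma power_eq_sum_Stirling_binomial:
  "x ^ q = (\<Sum>m\<le>q. Stirling q m * fact m * (x choose m))" for x q :: nat
proof (induction q)
  case 0
  then show ?case by simp
next
  case (Suc q)
  define g where "g m = fact m * (x choose m)" for m
  have g_step: "x * g m = m * g m + g (Suc m)" for m
  proof -
    have "m * (x choose m) + Suc m * (x choose Suc m) = x * (x choose m)"
    proof (cases x)
      case (Suc y)
      show ?thesis
      proof (cases "m \<le> x")
        case True
        have "Suc m * (x choose Suc m) = (x - m) * (x choose m)"
          by (metis binomial_absorb_comp binomial_absorption Suc mult.commute diff_Suc_1)
        with True show ?thesis
          by (metis add_mult_distrib le_add_diff_inverse)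
      qed (simp add: binomial_eq_0)
    qed (cases m; simp)
    from arg_cong[OF this, of "\<lambda>t. fact m * t"] show ?thesis
      by (simp add: g_def algebra_simps)
  qed
  have "x ^ Suc q = (\<Sum>m\<le>q. Stirling q m * (x * g m))"
    by (simp add: Suc.IH sum_distrib_left g_def mult_ac)
  also have "\<dots> = (\<Sum>m\<le>q. m * Stirling q m * g m) + (\<Sum>m\<le>q. Stirling q m * g (Suc m))"
    by (simp add: g_step algebra_simps sum.distrib)
  also have "(\<Sum>m\<le>q. m * Stirling q m * g m) = (\<Sum>m\<le>Suc q. m * Stirling q m * g m)"
    by simp
  also have "\<dots> = (\<Sum>m\<le>q. Suc m * Stirling q (Suc m) * g (Suc m))"
    by (subst sum.atMost_Suc_shift) simp
  also have "\<dots> + (\<Sum>m\<le>q. Stirling q m * g (Suc m))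
      = (\<Sum>m\<le>q. Stirling (Suc q) (Suc m) * g (Suc m))"
    by (simp add: algebra_simps flip: sum.distrib)
  also have "\<dots> = (\<Sum>m\<le>Suc q. Stirling (Suc q) m * g m)"
    by (simp only: sum.atMost_Suc_shift[of _ q]) simp
  finally show ?case by (simp add: g_def mult_ac)
qed

text \<open>
  A version of \<open>fps_prod_nth'\<close> for tuples: a multiset of size \<open>s\<close> over \<open>A\<close> is the same
  thing as its multiplicity function on \<open>A\<close>.
\<close>

lemma fps_nth_prod_eq_sum_PiE:
  fixes F :: "'a \<Rightarrow> 'b :: comm_ring_1 fps"
  assumes "finite A"
  shows "fps_nth (\<Prod>i\<in>A. F i) s =
    (\<Sum>k\<in>{k \<in> A \<rightarrow>\<^sub>E UNIV. sum k A = s}. \<Prod>i\<in>A. fps_nth (F i) (k i))"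
proof -
  let ?ms = "\<lambda>k. \<Sum>i\<in>A. replicate_mset (k i) i"
  have count_ms: "count (?ms k) i = (if i \<in> A then k i else 0)" for k i
    using assms by (simp add: count_sum if_distrib cong: if_cong)
  show ?thesis
    unfolding fps_prod_nth'[OF assms]
  proof (rule sum.reindex_bij_witness[where i = ?ms and j = "\<lambda>X. restrict (count X) A"])
    fix X assume "X \<in> multisets_of_size A s"
    then have X: "set_mset X \<subseteq> A" "size X = s"
      by (auto simp: multisets_of_size_def)
    show "?ms (restrict (count X) A) = X"
      using X by (intro multiset_eqI) (auto simp: count_ms not_in_iff)
    have "sum (count X) A = size X"
      unfolding size_multiset_overloaded_eq
      using X assms by (intro sum.mono_neutral_right) (auto simp: not_in_iff)
    with X show "restrict (count X) A \<in> {k \<in> A \<rightarrow>\<^sub>E UNIV. sum k A = s}"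
      by simp
  next
    fix k assume k: "k \<in> {k \<in> A \<rightarrow>\<^sub>E UNIV. sum k A = s}"
    show "restrict (count (?ms k)) A = k"
    proof
      show "restrict (count (?ms k)) A i = k i" for i
        using k PiE_arb[of k A "\<lambda>_. UNIV" i] by (cases "i \<in> A") (simp_all add: count_ms)
    qed
    show "?ms k \<in> multisets_of_size A s"
    proof -
      have "set_mset (?ms k) \<subseteq> A"
        using assms by (auto simp: set_mset_sum split: if_splits)
      moreover have "size (?ms k) = s"
        using k by (simp add: size_multiset_sum)
      ultimately show ?thesis by (simp add: multisets_of_size_def)
    qed
  qed simp
qed

text \<open>
  By exponential generating functions: every coordinate other than \<open>i\<close> contributes \<open>e\<^sup>X\<close>, and
  coordinate \<open>i\<close> contributes \<open>\<Sum>\<^sub>t binom(t, m) X\<^sup>t / t! = X\<^sup>m e\<^sup>X / m!\<close>. The product is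
  \<open>X\<^sup>m e\<^bsup>card A * X\<^esup> / m!\<close>, whose coefficients are known. For \<open>m > s\<close> both sides vanish, so the
  truncated exponent \<open>s - m\<close> does no harm.
\<close>

lemma sum_multinomial_binomial:
  assumes "finite A" "i \<in> A"
  shows "(\<Sum>k\<in>{k \<in> A \<rightarrow>\<^sub>E UNIV. sum k A = s}.
            fact s / (\<Prod>l\<in>A. fact (k l)) * of_nat (k i choose m))
         = of_nat (s choose m) * (of_nat (card A) :: 'a :: field_char_0) ^ (s - m)"
proof -
  let ?K = "{k \<in> A \<rightarrow>\<^sub>E UNIV. sum k A = s}"
  define G :: "'a fps" where "G = fps_const (1 / fact m) * (fps_X ^ m * fps_exp 1)"
  define F where "F l = (if l = i then G else fps_exp 1)" for l
  have G_nth: "fps_nth G t = of_nat (t choose m) / fact t" for t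
    by (auto simp: G_def fps_X_power_mult_nth binomial_fact binomial_eq_0)
  have "(\<Prod>l\<in>A. fps_nth (F l) (k l)) = of_nat (k i choose m) / (\<Prod>l\<in>A. fact (k l))" for k
  proof -
    have "(\<Prod>l\<in>A. fps_nth (F l) (k l))
        = (\<Prod>l\<in>A. (if l = i then of_nat (k i choose m) else 1) / fact (k l))"
      by (intro prod.cong) (auto simp: F_def G_nth)
    with assms show ?thesis by (simp add: prod_dividef)
  qed
  then have "(\<Sum>k\<in>?K. fact s / (\<Prod>l\<in>A. fact (k l)) * of_nat (k i choose m))
      = fact s * fps_nth (\<Prod>l\<in>A. F l) s"
    by (simp add: fps_nth_prod_eq_sum_PiE[OF assms(1)] sum_distrib_left)
  also have "(\<Prod>l\<in>A. F l) = G * (\<Prod>l\<in>A - {i}. fps_exp 1)"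
    unfolding prod.remove[OF assms] by (auto simp: F_def intro!: prod.cong)
  also have "\<dots> = fps_const (1 / fact m) * (fps_X ^ m * (\<Prod>l\<in>A. fps_exp 1))"
    unfolding prod.remove[OF assms, of "\<lambda>_. fps_exp 1"] by (simp add: G_def mult_ac)
  also have "(\<Prod>l\<in>A. fps_exp (1 :: 'a)) = fps_exp (of_nat (card A))"
    by (simp add: fps_exp_power_mult)
  also have "fact s * fps_nth (fps_const (1 / fact m) * (fps_X ^ m * fps_exp (of_nat (card A)))) s
      = of_nat (s choose m) * (of_nat (card A) :: 'a) ^ (s - m)"
    by (auto simp: fps_X_power_mult_nth binomial_fact binomial_eq_0)
  finally show ?thesis .
qed

lemma sum_multinomial_power:
  assumes "finite A" "i \<in> A"
  shows "(\<Sum>k\<in>{k \<in> A \<rightarrow>\<^sub>E UNIV. sum k A = s}.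
            fact s / (\<Prod>l\<in>A. fact (k l)) * of_nat (k i) ^ q)
         = (\<Sum>m\<le>q. of_nat (Stirling q m) * fact m * of_nat (s choose m)
              * (of_nat (card A) :: 'a :: field_char_0) ^ (s - m))"
proof -
  let ?K = "{k \<in> A \<rightarrow>\<^sub>E UNIV. sum k A = s}"
  have pow: "(of_nat x :: 'a) ^ q
      = (\<Sum>m\<le>q. of_nat (Stirling q m) * fact m * of_nat (x choose m))" for x
    by (simp add: power_eq_sum_Stirling_binomial flip: of_nat_power)
  have "(\<Sum>k\<in>?K. fact s / (\<Prod>l\<in>A. fact (k l)) * (of_nat (k i) :: 'a) ^ q)
      = (\<Sum>m\<le>q. \<Sum>k\<in>?K. of_nat (Stirling q m) * fact m *
          (fact s / (\<Prod>l\<in>A. fact (k l)) * of_nat (k i choose m)))"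
    by (subst sum.swap) (simp add: pow sum_distrib_left mult_ac)
  then show ?thesis
    unfolding sum_distrib_left[symmetric] sum_multinomial_binomial[OF assms] by (simp only: mult_ac)
qed

text \<open>
  A falling factorial is, up to sign, the rising factorial of \<open>-x\<close>, whose coefficients are the
  unsigned Stirling numbers of the first kind.
\<close>

lemma fact_binomial_eq_sum_stirling:
  "(fact m * of_nat (x choose m) :: 'a :: field_char_0)
    = (\<Sum>j\<le>m. (-1) ^ (m - j) * of_nat (stirling m j) * of_nat x ^ j)"
proof -
  have sign: "(-1) ^ m * (- of_nat x) ^ j = ((-1) ^ (m - j) * of_nat x ^ j :: 'a)" if "j \<le> m" for j
    using that by (auto simp: power_minus[of "of_nat x"] uminus_power_if even_diff_nat)
  have "(fact m * of_nat (x choose m) :: 'a) = (-1) ^ m * pochhammer (- of_nat x) m"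
    by (simp add: binomial_gbinomial gbinomial_pochhammer)
  also have "\<dots> = (\<Sum>j\<le>m. of_nat (stirling m j) * ((-1) ^ m * (- of_nat x) ^ j))"
    by (simp add: sum_distrib_left mult_ac flip: stirling_pochhammer)
  also have "\<dots> = (\<Sum>j\<le>m. (-1) ^ (m - j) * of_nat (stirling m j) * of_nat x ^ j)"
    by (intro sum.cong) (auto simp: sign mult_ac)
  finally show ?thesis .
qed

text \<open>
  The substitution \<open>m = k + j\<close> in the expansion of the falling factorials. The factors
  \<open>x ^ (q - m)\<close> make the left-hand side homogeneous: multiplied by the \<open>x ^ j\<close> of the expansion they
  give \<open>x ^ (q - k)\<close>, which depends on \<open>k\<close> alone. So the sum over \<open>j\<close> separates, and no
  negative exponents occur.
\<close>

lemma sum_Stirling_binomial_eq_sum_Stirling_stirling: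
  assumes "q \<ge> 1"
  shows "(\<Sum>m\<le>q. of_nat (Stirling q m) * fact m * of_nat (x choose m) * of_nat x ^ (q - m))
    = (of_nat x :: 'a :: field_char_0) * (\<Sum>k=0..q-1. (-1) ^ k *
        (\<Sum>j=1..q-k. of_nat (Stirling q (k + j)) * of_nat (stirling (k + j) j)) *
        of_nat x ^ (q - k - 1))"
proof -
  define T :: "nat \<Rightarrow> nat \<Rightarrow> 'a" where "T k j =
    (-1) ^ k * (of_nat (Stirling q (k + j)) * of_nat (stirling (k + j) j)) * of_nat x ^ (q - k)" for k j
  have "(\<Sum>m\<le>q. of_nat (Stirling q m) * fact m * of_nat (x choose m) * of_nat x ^ (q - m))
      = (\<Sum>m\<le>q. \<Sum>j\<le>m. T (m - j) j)"
  proof (rule sum.cong)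
    fix m assume "m \<in> {..q}"
    then have "of_nat x ^ j * of_nat x ^ (q - m) = (of_nat x ^ (q - (m - j)) :: 'a)" if "j \<le> m" for j
      using that by (simp add: add.commute flip: power_add)
    then have "(-1) ^ (m - j) * of_nat (stirling m j) * of_nat x ^ j
        * (of_nat (Stirling q m) * of_nat x ^ (q - m)) = T (m - j) j" if "j \<le> m" for j
      using that unfolding T_def by (subst (asm) eq_commute) (simp add: mult_ac)
    then have "(\<Sum>j\<le>m. (-1) ^ (m - j) * of_nat (stirling m j) * of_nat x ^ j)
        * (of_nat (Stirling q m) * of_nat x ^ (q - m)) = (\<Sum>j\<le>m. T (m - j) j)"
      by (simp add: sum_distrib_right)
    then show "of_nat (Stirling q m) * fact m * of_nat (x choose m) * of_nat x ^ (q - m)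
        = (\<Sum>j\<le>m. T (m - j) j)"
      unfolding fact_binomial_eq_sum_stirling[symmetric] by (simp only: mult_ac)
  qed simp
  \<comment> \<open>Since \<open>q \<ge> 1\<close>, every term with \<open>j = 0\<close> vanishes: for \<open>m > 0\<close> because \<open>stirling m 0 = 0\<close>,
    and for \<open>m = 0\<close> because \<open>Stirling q 0 = 0\<close>.\<close>
  also have "\<dots> = (\<Sum>m\<le>q. \<Sum>j=1..m. T (m - j) j)"
  proof (rule sum.cong)
    fix m
    have "T m 0 = 0"
      using assms by (cases m; cases q) (auto simp: T_def)
    then show "(\<Sum>j\<le>m. T (m - j) j) = (\<Sum>j=1..m. T (m - j) j)"
      by (simp add: atMost_atLeast0 sum.atLeast_Suc_atMost)
  qed simp
  also have "\<dots> = (\<Sum>k=0..q-1. \<Sum>j=1..q-k. T k j)"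
    unfolding sum.Sigma[OF finite_atMost ballI[OF finite_atLeastAtMost]]
      sum.Sigma[OF finite_atLeastAtMost ballI[OF finite_atLeastAtMost]]
    by (rule sum.reindex_bij_witness[where i = "\<lambda>(k, j). (k + j, j)" and j = "\<lambda>(m, j). (m - j, j)"])
      (use assms in auto)
  also have "\<dots> = of_nat x * (\<Sum>k=0..q-1. (-1) ^ k *
        (\<Sum>j=1..q-k. of_nat (Stirling q (k + j)) * of_nat (stirling (k + j) j)) *
        of_nat x ^ (q - k - 1))"
    unfolding sum_distrib_left
  proof (rule sum.cong)
    fix k assume "k \<in> {0..q-1}"
    then have "of_nat x ^ (q - k) = of_nat x * (of_nat x ^ (q - k - 1) :: 'a)"
      using assms by (subst power_Suc[symmetric]) (simp add: Suc_diff_Suc)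
    then show "(\<Sum>j=1..q-k. T k j) = of_nat x * ((\<Sum>j=1..q-k. (-1) ^ k *
        (of_nat (Stirling q (k + j)) * of_nat (stirling (k + j) j))) * of_nat x ^ (q - k - 1))"
      by (simp add: T_def sum_distrib_left sum_distrib_right mult_ac)
  qed simp
  finally show ?thesis .
qed

theorem corollary2p6:
  fixes n q :: nat
  assumes "n \<ge> 1" and "q \<ge> 1"
  shows "(\<Sum>k \<in> tuples_with_sum n. multinomial n k * (\<Sum>i=1..n. of_nat (k i) ^ q)) =
           (of_nat n :: rat) powi (int n - (int q - 2)) *
           (\<Sum>k=0..q-1. (-1) ^ k *
              (\<Sum>j=1..q-k. of_nat (Stirling q (k + j)) * of_nat (stirling (k + j) j)) *
              of_nat n ^ (q - k - 1))
         \<and> (\<Sum>k=0..q-1. (-1) ^ k *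
              (\<Sum>j=1..q-k. of_nat (Stirling q (k + j)) * of_nat (stirling (k + j) j))) = (1 :: rat)"
proof
  let ?R = "\<lambda>x. \<Sum>k=0..q-1. (-1) ^ k *
    (\<Sum>j=1..q-k. of_nat (Stirling q (k + j)) * of_nat (stirling (k + j) j)) *
    (of_nat x :: rat) ^ (q - k - 1)"
  let ?b = "\<lambda>x m. of_nat (Stirling q m) * fact m * (of_nat (x choose m) :: rat)"
  let ?L = "\<Sum>k \<in> tuples_with_sum n. multinomial n k * (\<Sum>i=1..n. of_nat (k i) ^ q)"
  have "?L = (\<Sum>i=1..n. \<Sum>k\<in>tuples_with_sum n. multinomial n k * of_nat (k i) ^ q)"
    by (subst sum.swap) (simp add: sum_distrib_left)
  also have "\<dots> = (\<Sum>i=1..n. \<Sum>m\<le>q. ?b n m * of_nat n ^ (n - m))"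
    unfolding tuples_with_sum_def multinomial_def
    by (intro sum.cong[OF refl], subst sum_multinomial_power) simp_all
  finally have L: "?L = of_nat n * (\<Sum>m\<le>q. ?b n m * of_nat n ^ (n - m))"
    by simp
  \<comment> \<open>Multiplying by \<open>n ^ q\<close> turns \<open>n ^ (n - m)\<close> into the homogenising factor \<open>n ^ (q - m)\<close> and
    clears the possibly negative exponent on the right-hand side.\<close>
  have shift: "?b n m * of_nat n ^ (n - m) * of_nat n ^ q
      = of_nat n ^ n * (?b n m * of_nat n ^ (q - m))" if "m \<le> q" for m
  proof (cases "m \<le> n")
    case True
    with that have "n - m + q = n + (q - m)" by simp
    then have "(of_nat n :: rat) ^ (n - m) * of_nat n ^ q = of_nat n ^ n * of_nat n ^ (q - m)"
      by (metis power_add)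
    then show ?thesis by (simp only: mult.assoc) (simp only: mult_ac)
  qed (simp add: binomial_eq_0)
  have "?L * of_nat n ^ q = of_nat n * (\<Sum>m\<le>q. ?b n m * of_nat n ^ (n - m) * of_nat n ^ q)"
    unfolding L by (simp only: mult.assoc sum_distrib_right)
  also have "(\<Sum>m\<le>q. ?b n m * of_nat n ^ (n - m) * of_nat n ^ q)
      = (\<Sum>m\<le>q. of_nat n ^ n * (?b n m * of_nat n ^ (q - m)))"
    by (rule sum.cong[OF refl], rule shift) simp
  also have "\<dots> = of_nat n ^ n * (of_nat n * ?R n)"
    unfolding sum_Stirling_binomial_eq_sum_Stirling_stirling[OF assms(2), symmetric]
    by (simp only: sum_distrib_left)
  also have "of_nat n * \<dots> = of_nat n powi (int n - (int q - 2)) * ?R n * of_nat n ^ q"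
  proof -
    have "(of_nat n :: rat) powi (int n - (int q - 2)) * of_nat n ^ q = of_nat n ^ (n + 2)"
      using assms(1) by (subst (1 2) power_int_of_nat[symmetric], subst power_int_add[symmetric])
        (simp_all del: power_int_of_nat add: add.commute)
    moreover have "of_nat n powi (int n - (int q - 2)) * ?R n * of_nat n ^ q
        = (of_nat n powi (int n - (int q - 2)) * of_nat n ^ q) * ?R n"
      by (simp only: mult_ac)
    ultimately show ?thesis
      by (simp only: power_add power2_eq_square mult_ac)
  qed
  finally show "?L = of_nat n powi (int n - (int q - 2)) * ?R n"
    using assms(1) by simp
  \<comment> \<open>The same identity at \<open>x = 1\<close>, where the left-hand side is the expansion of \<open>1 ^ q\<close>.\<close>
  have "?R 1 = of_nat (\<Sum>m\<le>q. Stirling q m * fact m * (1 choose m))"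
    using sum_Stirling_binomial_eq_sum_Stirling_stirling[OF assms(2), of 1, where 'a = rat] by simp
  also have "\<dots> = 1"
    by (simp flip: power_eq_sum_Stirling_binomial)
  finally show "(\<Sum>k=0..q-1. (-1) ^ k *
      (\<Sum>j=1..q-k. of_nat (Stirling q (k + j)) * of_nat (stirling (k + j) j))) = (1 :: rat)"
    by simp
qed

end
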